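(* The action of the triality automorphism on $\theta=(\theta_1,\theta_2,\theta_3,\theta_4)\in\mathbb{C}^4$ permutes $\theta_1,\theta_2,\theta_3$ cyclically and fixes $\theta_4$. The fixed locus $\theta_1=\theta_2=\theta_3$ maps onto the parameter space $\{b_1=b_2=b_3\}\subset\mathbb{C}^4$ of the symmetric Fricke cubic surfaces under the map $\theta\mapsto(b_1,b_2,b_3,c)$.
   Context: Here $\mathbb{C}^4$ (with orthonormal basis $\varepsilon_1,\dots,\varepsilon_4$ and $\theta=\sum\theta_i\varepsilon_i$) is regarded as the Cartan subalgebra of type $D_4$ with root system $$D_4^-=\Bigl\{\pm\varepsilon_1,\ \pm\varepsilon_2,\ \pm\varepsilon_3,\ \pm\varepsilon_4,\ \tfrac12(\pm\varepsilon_1\pm\varepsilon_2\pm\varepsilon_3\pm\varepsilon_4)\Bigr\},$$ with simple roots $\alpha_1=\varepsilon_1$, $\alpha_2=\varepsilon_2$, $\alpha_3=\varepsilon_3$, $\alpha_4=\frac12(\varepsilon_4-\varepsilon_1-\varepsilon_2-\varepsilon_3)$ (so $\alpha_4$ is the central node of the $D_4$ Dynkin diagram). The triality automorphism (defined up to inner automorphisms) is the linear automorphism of $\mathbb{C}^4$ induced by the order three automorphism of the Dynkin diagram permuting $\alpha_1\mapsto\alpha_2\mapsto\alpha_3\mapsto\alpha_1$ cyclically and fixing $\alpha_4$. The parameters $\theta$ label the eigenvalues $\exp(\pm\pi\sqrt{-1}\,\theta_i)$ of the monodromies for $\mathrm{SL}_2(\mathbb{C})$ representations of the fundamental group of the four-punctured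 sphere, so that the corresponding traces are $m_i=2\cos(\pi\theta_i)$, $i=1,2,3,4$. The map $\theta\mapsto(b_1,b_2,b_3,c)$ to the parameters of the Fricke cubic surface $xyz+x^2+y^2+z^2+b_1x+b_2y+b_3z+c=0$ is given by $$b_1=-(m_1m_4+m_2m_3),\quad b_2=-(m_2m_4+m_1m_3),\quad b_3=-(m_3m_4+m_1m_2),\quad c=m_1m_2m_3m_4-4+\sum_{i=1}^4m_i^2.$$ A Fricke surface is symmetric if $b_1=b_2=b_3$. *)

theory Defs
  imports "HOL-Analysis.Analysis"
begin

text \<open>
  Indices are elements of the type \<^typ>\<open>4\<close>, where the numeral \<open>4\<close> denotes the same element
  as \<open>0\<close>, so \<open>v $ 1\<close>, \<open>v $ 2\<close>, \<open>v $ 3\<close>, \<open>v $ 4\<close> are the four coordinates of \<open>v\<close>.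
\<close>

abbreviation \<epsilon> :: "4 \<Rightarrow> complex ^ 4" where
  "\<epsilon> i \<equiv> axis i 1"

text \<open>The \<open>\<complex>\<close>-bilinear form for which the \<open>\<epsilon> i\<close> are orthonormal; the library inner product on
  \<^typ>\<open>complex ^ 4\<close> is only real bilinear.\<close>

definition bilin :: "complex ^ 4 \<Rightarrow> complex ^ 4 \<Rightarrow> complex" where
  "bilin v w = (\<Sum>i\<in>UNIV. v $ i * w $ i)"

definition D4_minus :: "(complex ^ 4) set" where
  "D4_minus = {s *s \<epsilon> i | s i. s \<in> {1, -1}} \<union>
     {(1/2) *s (\<Sum>i\<in>UNIV. s i *s \<epsilon> i) | s. range s \<subseteq> {1, -1}}"

definition simple_root :: "4 \<Rightarrow> complex ^ 4" where
  "simple_root i = (if i = 4 then (1/2) *s (\<epsilon> 4 - \<epsilon> 1 - \<epsilon> 2 - \<epsilon> 3) else \<epsilon> i)"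

definition cartan_integer :: "4 \<Rightarrow> 4 \<Rightarrow> complex" where
  "cartan_integer i j =
     2 * bilin (simple_root i) (simple_root j) / bilin (simple_root j) (simple_root j)"

definition diagram_rotation :: "4 \<Rightarrow> 4" where
  "diagram_rotation i = (if i = 1 then 2 else if i = 2 then 3 else if i = 3 then 1 else 4)"

text \<open>Triality is defined only up to inner automorphisms; this is the representative fixed by the
  choice of simple roots. The description determines a unique map because the simple roots form
  a basis of \<open>\<complex>\<^sup>4\<close>.\<close>

definition triality :: "complex ^ 4 \<Rightarrow> complex ^ 4" where
  "triality = (THE T. Vector_Spaces.linear (*s) (*s) T \<and>
     (\<forall>i. T (simple_root i) = simple_root (diagram_rotation i)))"

text \<open>The trace of a matrix in \<open>SL\<^sub>2(\<complex>)\<close> with eigenvalues \<open>exp (\<plusminus>\<pi>\<i>t)\<close>.\<close>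

definition monodromy_trace :: "complex \<Rightarrow> complex" where
  "monodromy_trace t = 2 * cos (complex_of_real pi * t)"

text \<open>The vector \<open>(b\<^sub>1, b\<^sub>2, b\<^sub>3, c)\<close> of parameters of the Fricke cubic surface
  \<open>xyz + x\<^sup>2 + y\<^sup>2 + z\<^sup>2 + b\<^sub>1x + b\<^sub>2y + b\<^sub>3z + c = 0\<close>.\<close>

definition fricke_params :: "complex ^ 4 \<Rightarrow> complex ^ 4" where
  "fricke_params \<theta> = (let m = (\<lambda>i. monodromy_trace (\<theta> $ i)) in
     vector [- (m 1 * m 4 + m 2 * m 3),
             - (m 2 * m 4 + m 1 * m 3),
             - (m 3 * m 4 + m 1 * m 2),
             m 1 * m 2 * m 3 * m 4 - 4 + (\<Sum>i\<in>UNIV. (m i)\<^sup>2)])"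

definition symmetric_fricke_params :: "(complex ^ 4) set" where
  "symmetric_fricke_params = {p. p $ 1 = p $ 2 \<and> p $ 2 = p $ 3}"

text \<open>The simple roots form a base of the root system, its Dynkin diagram is that of type
  \<open>D\<^sub>4\<close> with central node \<open>4\<close>, and \<^const>\<open>diagram_rotation\<close> is an automorphism of
  the diagram of order three.\<close>

lemma simple_root_in_D4_minus: "simple_root i \<in> D4_minus"
proof (cases "i = 4")
  case True
  let ?s = "\<lambda>j::4. if j = 4 then 1 else -1 :: complex"
  have "simple_root i = (1/2) *s (\<Sum>j\<in>UNIV. ?s j *s \<epsilon> j)"
    using True by (simp add: simple_root_def sum_4 vec_eq_iff axis_def forall_4)
  moreover have "range ?s \<subseteq> {1, -1}" by auto
  ultimately show ?thesis
    unfolding D4_minus_def by (intro UnI2 CollectI exI[of _ ?s] conjI)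
next
  case False
  then have "simple_root i = 1 *s \<epsilon> i" by (simp add: simple_root_def)
  then show ?thesis
    unfolding D4_minus_def by (intro UnI1 CollectI exI[of _ 1] exI[of _ i] conjI) simp_all
qed

lemma D4_minus_base:
  assumes "\<alpha> \<in> D4_minus"
  shows "\<exists>n :: 4 \<Rightarrow> nat. \<exists>s\<in>{1, -1}. \<alpha> = s *s (\<Sum>i\<in>UNIV. of_nat (n i) *s simple_root i)"
proof -
  define c :: "nat \<Rightarrow> nat \<Rightarrow> nat \<Rightarrow> nat \<Rightarrow> complex ^ 4" where
    "c p q r t = (\<Sum>i\<in>UNIV. of_nat (if i = 1 then p else if i = 2 then q else
       if i = 3 then r else t) *s simple_root i)" for p q r t
  have c: "c p q r t = (\<chi> i. if i = 1 then of_nat p - of_nat t / 2 else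
      if i = 2 then of_nat q - of_nat t / 2 else
      if i = 3 then of_nat r - of_nat t / 2 else of_nat t / 2)" for p q r t
    by (simp add: c_def simple_root_def sum_4 vec_eq_iff forall_4 axis_def)
  have ex: ?thesis if "s = 1 \<or> s = -1" "\<alpha> = s *s c p q r t" for s p q r t
    using that unfolding c_def by (intro exI bexI[of _ s]) auto
  consider (short) s i where "s = 1 \<or> s = -1" "\<alpha> = s *s \<epsilon> i"
    | (half) s where "range s \<subseteq> {1, -1}" "\<alpha> = (1/2) *s (\<Sum>i\<in>UNIV. s i *s \<epsilon> i)"
    using assms unfolding D4_minus_def by blast
  then show ?thesis
  proof cases
    case short
    have "\<epsilon> 1 = c 1 0 0 0" "\<epsilon> 2 = c 0 1 0 0" "\<epsilon> 3 = c 0 0 1 0" "\<epsilon> 4 = c 1 1 1 2"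
      by (simp_all add: c vec_eq_iff forall_4 axis_def)
    then obtain p q r t where "\<epsilon> i = c p q r t"
      using exhaust_4[of i] by blast
    with short have "\<alpha> = s *s c p q r t" by simp
    then show ?thesis by (rule ex[OF short(1)])
  next
    case half
    define u where "u i = (if s i = s 4 then 1 else 0 :: nat)" for i
    have s: "s i = 1 \<or> s i = -1" for i
      using half(1) by blast
    have u: "s i = s 4 * (2 * of_nat (u i) - 1)" for i
      using s[of i] s[of 4] by (auto simp: u_def)
    have "\<alpha> $ j = (s 4 *s c (u 1) (u 2) (u 3) 1) $ j" for j
    proof -
      have "\<alpha> $ j = s j / 2"
        unfolding half(2) by (simp add: axis_def if_distrib cong: if_cong)
      also have "\<dots> = s 4 * (of_nat (u j) - 1 / 2)"
        by (subst u) (simp add: field_simps)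
      also have "\<dots> = (s 4 *s c (u 1) (u 2) (u 3) 1) $ j"
        using exhaust_4[of j] by (elim disjE) (simp_all add: c u_def)
      finally show ?thesis .
    qed
    then have "\<alpha> = s 4 *s c (u 1) (u 2) (u 3) 1"
      unfolding vec_eq_iff by blast
    then show ?thesis by (rule ex[OF s])
  qed
qed

lemma simple_root_independent:
  assumes "(\<Sum>i\<in>UNIV. c i *s simple_root i) = 0"
  shows "c i = 0"
proof -
  have "(\<Sum>i\<in>UNIV. c i *s simple_root i) $ j = (if j = 4 then c 4 / 2 else c j - c 4 / 2)" for j
    using exhaust_4[of j] by (elim disjE) (simp_all add: simple_root_def sum_4 axis_def)
  then have eq: "(if j = 4 then c 4 / 2 else c j - c 4 / 2) = 0" for j
    using assms by simp
  from eq[of 4] have "c 4 = 0" by simp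
  with eq[of i] show ?thesis by (cases "i = 4") simp_all
qed

lemma cartan_integer_eq:
  "cartan_integer i j = (if i = j then 2 else if i = 4 \<or> j = 4 then -1 else 0)"
proof -
  have "bilin (simple_root i) (simple_root j) =
      (if i = j then 1 else if i = 4 \<or> j = 4 then -1/2 else 0)" for i j
    using exhaust_4[of i] exhaust_4[of j]
    by (elim disjE) (simp_all add: bilin_def simple_root_def sum_4 axis_def)
  then show ?thesis by (simp add: cartan_integer_def)
qed

lemma cartan_integer_diagram_rotation:
  "cartan_integer (diagram_rotation i) (diagram_rotation j) = cartan_integer i j"
  using exhaust_4[of i] exhaust_4[of j]
  by (elim disjE) (simp_all add: cartan_integer_eq diagram_rotation_def)

lemma diagram_rotation_order_three:
  "diagram_rotation ^^ 3 = id" "diagram_rotation \<noteq> id"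
proof -
  show "diagram_rotation ^^ 3 = id"
    by (simp add: fun_eq_iff forall_4 numeral_3_eq_3 diagram_rotation_def)
  have "diagram_rotation 1 \<noteq> 1"
    by (simp add: diagram_rotation_def)
  then show "diagram_rotation \<noteq> id" by auto
qed

lemma vector_4:
  "(vector [w, x, y, z] :: 'a::zero ^ 4) $ 1 = w"
  "(vector [w, x, y, z] :: 'a ^ 4) $ 2 = x"
  "(vector [w, x, y, z] :: 'a ^ 4) $ 3 = y"
  "(vector [w, x, y, z] :: 'a ^ 4) $ 4 = z"
  unfolding vector_def by simp_all

lemma fricke_params_nth:
  fixes \<theta> :: "complex ^ 4"
  defines "m \<equiv> \<lambda>i. monodromy_trace (\<theta> $ i)"
  shows "fricke_params \<theta> $ 1 = - (m 1 * m 4 + m 2 * m 3)"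
    and "fricke_params \<theta> $ 2 = - (m 2 * m 4 + m 1 * m 3)"
    and "fricke_params \<theta> $ 3 = - (m 3 * m 4 + m 1 * m 2)"
    and "fricke_params \<theta> $ 4 = m 1 * m 2 * m 3 * m 4 - 4 + (\<Sum>i\<in>UNIV. (m i)\<^sup>2)"
  unfolding fricke_params_def m_def Let_def by (rule vector_4)+

end

theory Submission
  imports Defs "HOL-Computational_Algebra.Fundamental_Theorem_Algebra"
begin

text \<open>
  On the fixed locus \<open>m\<^sub>1 = m\<^sub>2 = m\<^sub>3 = m\<close>, so with \<open>n = m\<^sub>4\<close> one has to solve
  \<open>b = - (m n + m\<^sup>2)\<close> and \<open>c = m\<^sup>3 n - 4 + 3 m\<^sup>2 + n\<^sup>2\<close>. For \<open>b = 0\<close> take \<open>m = 0\<close> and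
  \<open>n\<^sup>2 = c + 4\<close>. Otherwise \<open>m \<noteq> 0\<close>, and eliminating \<open>n = - (b + m\<^sup>2) / m\<close> leaves a cubic in
  \<open>u = m\<^sup>2\<close> with constant term \<open>- b\<^sup>2 \<noteq> 0\<close>, which has a nonzero root. Finally, the cosine is
  surjective on \<open>\<complex>\<close>.
\<close>

text \<open>Only \<open>simple_root 4\<close> involves \<open>\<epsilon> 4\<close>, with coefficient
  1/2, so its coefficient is read off first and then corrects the other three.\<close>

lemma simple_root_expansion:
  "v = (\<Sum>i\<in>UNIV. (if i = 4 then 2 * v $ 4 else v $ i + v $ 4) *s simple_root i)"
  by (simp add: vec_eq_iff forall_4 sum_4 simple_root_def axis_def)

text \<open>Supplies the uniqueness behind the definite description in
  \<open>triality\<close>.\<close>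

lemma linear_eq_on_simple_roots:
  assumes "Vector_Spaces.linear (*s) (*s) S" "Vector_Spaces.linear (*s) (*s) T"
    and eq: "\<And>i. S (simple_root i) = T (simple_root i)"
  shows "S = T"
proof
  fix v :: "complex ^ 4"
  interpret S: Vector_Spaces.linear "(*s)" "(*s)" S by fact
  interpret T: Vector_Spaces.linear "(*s)" "(*s)" T by fact
  show "S v = T v"
    by (subst (1 2) simple_root_expansion[of v]) (simp only: S.sum T.sum S.scale T.scale eq)
qed

text \<open>A cyclic shift of the first three coordinates fixes \<open>simple_root 4\<close>, which
  is symmetric in them.\<close>

lemma triality_eq: "triality = (\<lambda>v. vector [v $ 3, v $ 1, v $ 2, v $ 4])"
proof -
  let ?T = "\<lambda>v :: complex ^ 4. vector [v $ 3, v $ 1, v $ 2, v $ 4] :: complex ^ 4"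
  have lin: "Vector_Spaces.linear (*s) (*s) ?T"
    by unfold_locales (simp_all add: vec_eq_iff forall_4 vector_4 algebra_simps)
  have root: "?T (simple_root i) = simple_root (diagram_rotation i)" for i
    using exhaust_4[of i]
    by (elim disjE)
       (simp_all add: vec_eq_iff forall_4 vector_4 simple_root_def diagram_rotation_def axis_def)
  show ?thesis
    unfolding triality_def
    using lin root by (intro the_equality) (auto intro!: linear_eq_on_simple_roots)
qed

lemma monodromy_trace_surj: "surj monodromy_trace"
proof (rule surjI)
  show "monodromy_trace (Arccos (m / 2) / complex_of_real pi) = m" for m
    by (simp add: monodromy_trace_def)
qed

lemma symmetric_trace_equations_solvable:
  fixes b c :: complex
  obtains m n where "b = - (m * n + m\<^sup>2)" "c = m ^ 3 * n - 4 + 3 * m\<^sup>2 + n\<^sup>2"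
proof (cases "b = 0")
  case True
  show ?thesis
    by (rule that[of 0 "csqrt (c + 4)"]) (simp_all add: True)
next
  case False
  \<comment> \<open>Obtained by multiplying the equation for \<open>c\<close> by \<open>u\<close>
    and substituting \<open>m * n = - (b + u)\<close>.\<close>
  let ?p = "[:- b\<^sup>2, 4 + c - 2 * b, b - 4, 1:]"
  obtain u where u: "poly ?p u = 0"
    using fundamental_theorem_of_algebra[of ?p] by (auto simp: constant_degree)
  with False have "u \<noteq> 0" by auto
  define m where "m = csqrt u"
  have m: "m\<^sup>2 = u" "m \<noteq> 0" using \<open>u \<noteq> 0\<close> by (auto simp: m_def)
  define n where "n = - (b + u) / m"
  have mn: "m * n = - (b + u)" using m by (simp add: n_def)
  have n2: "u * n\<^sup>2 = (b + u)\<^sup>2"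
    using m mn by (metis power2_minus power_mult_distrib)
  have m3n: "m ^ 3 * n = u * (- b - u)"
    using m mn by (simp add: power3_eq_cube power2_eq_square mult.assoc)
  have "u * c = u * (m ^ 3 * n - 4 + 3 * m\<^sup>2 + n\<^sup>2)"
    using u unfolding distrib_left n2 m m3n right_diff_distrib
    by (simp add: algebra_simps power2_eq_square)
  then have "c = m ^ 3 * n - 4 + 3 * m\<^sup>2 + n\<^sup>2" using \<open>u \<noteq> 0\<close> by simp
  moreover have "b = - (m * n + m\<^sup>2)" by (simp add: mn m)
  ultimately show ?thesis by (rule that[rotated])
qed

lemma fricke_params_image_diagonal:
  "fricke_params ` {\<theta>. \<theta> $ 1 = \<theta> $ 2 \<and> \<theta> $ 2 = \<theta> $ 3} = symmetric_fricke_params"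
proof (intro equalityI subsetI)
  fix p assume "p \<in> fricke_params ` {\<theta>. \<theta> $ 1 = \<theta> $ 2 \<and> \<theta> $ 2 = \<theta> $ 3}"
  then show "p \<in> symmetric_fricke_params"
    by (auto simp: symmetric_fricke_params_def fricke_params_nth)
next
  fix p assume p: "p \<in> symmetric_fricke_params"
  \<comment> \<open>The first three entries of \<open>p\<close> agree, so matching
    \<open>p $ 1\<close> and \<open>p $ 4\<close> suffices.\<close>
  obtain m n where mn: "p $ 1 = - (m * n + m\<^sup>2)" "p $ 4 = m ^ 3 * n - 4 + 3 * m\<^sup>2 + n\<^sup>2"
    by (rule symmetric_trace_equations_solvable)
  obtain s t where st: "m = monodromy_trace s" "n = monodromy_trace t"
    using monodromy_trace_surj by (metis surjD)
  let ?\<theta> = "vector [s, s, s, t] :: complex ^ 4"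
  have "fricke_params ?\<theta> = p"
    using p mn unfolding st symmetric_fricke_params_def
    by (simp add: vec_eq_iff forall_4 fricke_params_nth vector_4 sum_4
        power2_eq_square power3_eq_cube)
  then show "p \<in> fricke_params ` {\<theta>. \<theta> $ 1 = \<theta> $ 2 \<and> \<theta> $ 2 = \<theta> $ 3}"
    by (intro image_eqI[of _ _ ?\<theta>]) (simp_all add: vector_4)
qed

theorem proposition18:
  shows "(\<forall>\<theta>. triality \<theta> $ 1 = \<theta> $ 3 \<and> triality \<theta> $ 2 = \<theta> $ 1 \<and>
              triality \<theta> $ 3 = \<theta> $ 2 \<and> triality \<theta> $ 4 = \<theta> $ 4) \<and>
         {\<theta>. triality \<theta> = \<theta>} = {\<theta>. \<theta> $ 1 = \<theta> $ 2 \<and> \<theta> $ 2 = \<theta> $ 3} \<and>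
         fricke_params ` {\<theta>. triality \<theta> = \<theta>} = symmetric_fricke_params"
proof -
  have "{\<theta>. triality \<theta> = \<theta>} = {\<theta>. \<theta> $ 1 = \<theta> $ 2 \<and> \<theta> $ 2 = \<theta> $ 3}"
    by (auto simp: triality_eq vec_eq_iff forall_4 vector_4)
  then show ?thesis
    by (simp add: fricke_params_image_diagonal) (simp add: triality_eq vector_4)
qed

end
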